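(* Fix integers $r,n\ge 0$. For any $\pi\in\mathcal{S}_n$, define $\alpha_r(\pi)=\#\{i:\pi_i=i+r\}$ and $\beta_r(\pi)=\#\{i:i>r,\ \pi_i=i\}$. Then, for any $0\le k\le n$, the number of $321$-avoiding permutations $\pi\in\mathcal{S}_n$ with $\beta_r(\pi)=k$ equals the number of $132$-avoiding permutations $\pi\in\mathcal{S}_n$ with $\alpha_r(\pi)=k$.
   Context: $\mathcal{S}_n$ is the set of permutations $\pi=\pi_1\pi_2\cdots\pi_n$ of $\{1,\dots,n\}$. A permutation $\pi\in\mathcal{S}_n$ contains $\sigma\in\mathcal{S}_m$ ($m\le n$) if there are indices $i_1<\dots<i_m$ such that $\pi_{i_1}\cdots\pi_{i_m}$ is in the same relative order as $\sigma_1\cdots\sigma_m$; otherwise $\pi$ is $\sigma$-avoiding. *)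

theory Defs
  imports "HOL-Combinatorics.Permutations" "HOL-Library.FuncSet"
begin

(* Permutations in S_n are rendered as functions p with p permutes {1..n}; the entry pi_i of
   the one-line notation is p i. Such a p is the identity outside {1..n}, so all statistics below
   restrict indices to {1..n} explicitly. *)

definition sym_perms :: "nat \<Rightarrow> (nat \<Rightarrow> nat) set" where
  "sym_perms n = {p. p permutes {1..n}}"

(* The permutation with given one-line notation; list positions are 0-based, indices 1-based. *)
definition one_line :: "nat list \<Rightarrow> nat \<Rightarrow> nat" where
  "one_line xs i = (if i \<in> {1..length xs} then xs ! (i - 1) else i)"

(* The strictly increasing map f selects the positions f 1 < ... < f m of an occurrence;
   its existence forces m \<le> n. *)
definition contains_pattern ::
  "nat \<Rightarrow> (nat \<Rightarrow> nat) \<Rightarrow> nat \<Rightarrow> (nat \<Rightarrow> nat) \<Rightarrow> bool" where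
  "contains_pattern n p m s \<longleftrightarrow>
     (\<exists>f \<in> {1..m} \<rightarrow> {1..n}. strict_mono_on {1..m} f \<and>
        (\<forall>a\<in>{1..m}. \<forall>b\<in>{1..m}. p (f a) < p (f b) \<longleftrightarrow> s a < s b))"

definition avoiders :: "nat \<Rightarrow> nat \<Rightarrow> (nat \<Rightarrow> nat) \<Rightarrow> (nat \<Rightarrow> nat) set" where
  "avoiders n m s = {p \<in> sym_perms n. \<not> contains_pattern n p m s}"

definition alpha_stat :: "nat \<Rightarrow> nat \<Rightarrow> (nat \<Rightarrow> nat) \<Rightarrow> nat" where
  "alpha_stat r n p = card {i \<in> {1..n}. p i = i + r}"

definition beta_stat :: "nat \<Rightarrow> nat \<Rightarrow> (nat \<Rightarrow> nat) \<Rightarrow> nat" where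
  "beta_stat r n p = card {i \<in> {1..n}. r < i \<and> p i = i}"

lemma one_line_patterns:
  "one_line [3,2,1] \<in> sym_perms 3" "one_line [1,3,2] \<in> sym_perms 3"
proof -
  have 1: "{1..3::nat} = {1,2,3}" by auto
  have *: "q permutes {1..3::nat}"
    if "q ` {1,2,3} = {1,2,3}" and "\<And>i. i \<notin> {1..3} \<Longrightarrow> q i = i" for q
  proof (rule bij_imp_permutes)
    show "bij_betw q {1..3} {1..3}"
      unfolding bij_betw_def 1 using that(1)
      by (intro conjI eq_card_imp_inj_on) (simp_all only: finite.intros)
  qed (use that(2) in auto)
  show "one_line [3,2,1] \<in> sym_perms 3" "one_line [1,3,2] \<in> sym_perms 3"
    unfolding sym_perms_def mem_Collect_eq
    by (rule *; auto simp: one_line_def numeral_3_eq_3)+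
qed

end

theory Submission
  imports Defs "HOL-Combinatorics.Multiset_Permutations"
    "HOL-Computational_Algebra.Formal_Power_Series" "HOL-Computational_Algebra.Polynomial"
begin

text \<open>
  Both statistics have weight enumerators that satisfy one and the same recurrence. Write $C_n$ for
  the number of 132-avoiding permutations, which is also the number of 321-avoiding ones, and $X$
  for the variable that marks the statistic. With $F_{n,r}$ standing for either enumerator,
  \[ F_{n,r} = C_n + (X - 1) \sum_{i=r}^{n-1} C_i \, F_{n-1-i,0}. \]
  This determines all $F_{n,r}$ by induction on $n$, so the coefficients of $X^k$ agree.

  For 321-avoiders (\<open>fix_enum_eq\<close>) the recurrence is immediate: everything before a fixed point
  $i + 1$ must be smaller and everything after it larger, since an excess on one side forces a
  deficit on the other and hence a pattern 321. A fixed point therefore cuts the permutation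
  into two independent 321-avoiders of sizes $i$ and $n - 1 - i$, and
  expanding $X^m = 1 + (X-1)(1 + X + \cdots + X^{m-1})$ sums over a distinguished fixed point
  together with the weight of the fixed points after it.

  For 132-avoiders (\<open>diag_enum_eq\<close>) the recurrence is best seen on Dyck paths. A nonempty 132-avoider is
  \<open>L n R\<close> with every entry of \<open>L\<close> above every entry of \<open>R\<close>; sending it to the path \<open>U L D R\<close>
  turns the entries with $\pi_i = i + s$ into the tunnels (horizontal chords joining matching
  up and down steps) whose midpoint has abscissa $n - s$. These tunnels are nested. Cutting the
  outermost one out leaves an arbitrary Dyck path, and inside it sits a Dyck path with a centred
  family of tunnels, which gives the recurrence with $r = |s|$. Paths are not
  constructed below. Instead the decomposition \<open>L n R\<close> gives a quadratic recurrence for the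
  enumerators, over all integers $s$ simultaneously because the offset shifts in \<open>L\<close> and \<open>R\<close>; and
  the closed form solves it since a vertical line meets the path above at most one of \<open>L\<close> and \<open>R\<close>,
  so that the quadratic terms vanish, while the linear ones combine by the Catalan recurrence.

  That the two classes are equinumerous (\<open>card_Av321_eq_card_Av132\<close>) follows by inserting the
  largest entry into 321-avoiders, which yields the ballot numbers, and reading these off the
  powers of the Catalan generating function.
\<close>

section \<open>Pattern-avoiding words\<close>

text \<open>
  Words are tested for the patterns letter by letter. Testing sortedness of the letters on one
  side of the head makes the behaviour under appending and under insertion of a maximal letter
  a matter of plain list induction.
\<close>

fun avoids_321 :: "nat list \<Rightarrow> bool" where
  "avoids_321 [] \<longleftrightarrow> True"
| "avoids_321 (x # xs) \<longleftrightarrow> sorted (filter (\<lambda>y. y < x) xs) \<and> avoids_321 xs"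

fun avoids_132 :: "nat list \<Rightarrow> bool" where
  "avoids_132 [] \<longleftrightarrow> True"
| "avoids_132 (x # xs) \<longleftrightarrow> sorted (filter (\<lambda>y. x < y) xs) \<and> avoids_132 xs"

definition Av321 :: "nat \<Rightarrow> nat list set" where
  "Av321 n = {xs \<in> permutations_of_set {1..n}. avoids_321 xs}"

definition Av132 :: "nat \<Rightarrow> nat list set" where
  "Av132 n = {xs \<in> permutations_of_set {1..n}. avoids_132 xs}"

lemma finite_Av321 [simp]: "finite (Av321 n)" and finite_Av132 [simp]: "finite (Av132 n)"
  by (simp_all add: Av321_def Av132_def)

lemma length_perm: "xs \<in> permutations_of_set {1..n} \<Longrightarrow> length xs = n"
  by (metis card_atLeastAtMost diff_Suc_1 distinct_card permutations_of_setD)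

section \<open>One-line notation\<close>

lemma sorted_filter_iff_nth:
  fixes xs :: "'a::linorder list"
  shows "sorted (filter P xs) \<longleftrightarrow>
    (\<forall>i j. i < j \<longrightarrow> j < length xs \<longrightarrow> P (xs ! i) \<and> P (xs ! j) \<longrightarrow> xs ! i \<le> xs ! j)"
proof -
  have "sorted (filter P xs) \<longleftrightarrow> sorted_wrt (\<lambda>y z. P y \<and> P z \<longrightarrow> y \<le> z) xs"
    by (induction xs) auto
  then show ?thesis
    by (simp only: sorted_wrt_iff_nth_less)
qed

lemma ex_index_triple_Cons:
  "(\<exists>i j k. i < j \<and> j < k \<and> k < length (x # xs) \<and> Q ((x # xs) ! i) ((x # xs) ! j) ((x # xs) ! k)) \<longleftrightarrow>
   (\<exists>j k. j < k \<and> k < length xs \<and> Q x (xs ! j) (xs ! k)) \<or>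
   (\<exists>i j k. i < j \<and> j < k \<and> k < length xs \<and> Q (xs ! i) (xs ! j) (xs ! k))"
  (is "?L \<longleftrightarrow> ?A \<or> ?B")
proof
  assume ?L
  then obtain i j k where *: "i < j" "j < k" "k < length (x # xs)"
    "Q ((x # xs) ! i) ((x # xs) ! j) ((x # xs) ! k)" by blast
  then obtain j' k' where "j = Suc j'" "k = Suc k'"
    by (metis less_nat_zero_code not0_implies_Suc)
  with * show "?A \<or> ?B"
    by (cases i) auto
next
  assume "?A \<or> ?B"
  then show ?L
  proof
    assume ?A
    then obtain j k where "j < k" "k < length xs" "Q x (xs ! j) (xs ! k)" by blast
    then show ?L
      by (intro exI[of _ 0] exI[of _ "Suc j"] exI[of _ "Suc k"]) simp
  next
    assume ?B
    then obtain i j k where "i < j" "j < k" "k < length xs" "Q (xs ! i) (xs ! j) (xs ! k)" by blast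
    then show ?L
      by (intro exI[of _ "Suc i"] exI[of _ "Suc j"] exI[of _ "Suc k"]) simp
  qed
qed

lemma avoids_321_iff_nth:
  "avoids_321 xs \<longleftrightarrow>
    \<not> (\<exists>i j k. i < j \<and> j < k \<and> k < length xs \<and> xs ! k < xs ! j \<and> xs ! j < xs ! i)"
proof (induction xs)
  case (Cons x xs)
  have "(b < x \<and> c < x \<longrightarrow> b \<le> c) \<longleftrightarrow> \<not> (c < b \<and> b < x)" for b c
    by auto
  then have "sorted (filter (\<lambda>y. y < x) xs) \<longleftrightarrow>
      \<not> (\<exists>j k. j < k \<and> k < length xs \<and> xs ! k < xs ! j \<and> xs ! j < x)"
    unfolding sorted_filter_iff_nth by auto
  then show ?case
    unfolding ex_index_triple_Cons[where Q = "\<lambda>a b c. c < b \<and> b < a"] avoids_321.simps Cons.IH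
    by blast
qed simp

lemma avoids_132_iff_nth:
  "avoids_132 xs \<longleftrightarrow>
    \<not> (\<exists>i j k. i < j \<and> j < k \<and> k < length xs \<and> xs ! i < xs ! k \<and> xs ! k < xs ! j)"
proof (induction xs)
  case (Cons x xs)
  have "(x < b \<and> x < c \<longrightarrow> b \<le> c) \<longleftrightarrow> \<not> (x < c \<and> c < b)" for b c
    by auto
  then have "sorted (filter (\<lambda>y. x < y) xs) \<longleftrightarrow>
      \<not> (\<exists>j k. j < k \<and> k < length xs \<and> x < xs ! k \<and> xs ! k < xs ! j)"
    unfolding sorted_filter_iff_nth by auto
  then show ?case
    unfolding ex_index_triple_Cons[where Q = "\<lambda>a b c. a < c \<and> c < b"] avoids_132.simps Cons.IH
    by blast
qed simp

text \<open>
  A selection of three positions is a map on \<open>{1..3}\<close>, so \<^const>\<open>one_line\<close> can also serve to write it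
  down. The indices are shifted by one because list positions start at 0.
\<close>

lemma contains_pattern_3_iff:
  "contains_pattern n p 3 s \<longleftrightarrow>
    (\<exists>i j k. i < j \<and> j < k \<and> k < n \<and>
      (\<forall>a\<in>{1..3}. \<forall>b\<in>{1..3}. p (one_line [Suc i, Suc j, Suc k] a) < p (one_line [Suc i, Suc j, Suc k] b)
          \<longleftrightarrow> s a < s b))"
  (is "?L \<longleftrightarrow> ?R")
proof
  have three: "{1..3} = {1, 2, 3::nat}" by auto
  assume ?L
  then obtain f where f: "f \<in> {1..3} \<rightarrow> {1..n}" "strict_mono_on {1..3} f"
    "\<forall>a\<in>{1..3}. \<forall>b\<in>{1..3}. p (f a) < p (f b) \<longleftrightarrow> s a < s b"
    unfolding contains_pattern_def by blast
  have range: "1 \<le> f 1" "f 3 \<le> n" using f(1) by auto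
  have mono: "f 1 < f 2" "f 2 < f 3" using f(2) by (auto simp: strict_mono_on_def)
  define i j k where "i = f 1 - 1" and "j = f 2 - 1" and "k = f 3 - 1"
  have eq: "Suc i = f 1" "Suc j = f 2" "Suc k = f 3"
    using range mono by (auto simp: i_def j_def k_def)
  have "one_line [Suc i, Suc j, Suc k] a = f a" if "a \<in> {1..3}" for a
    using that unfolding eq three by (auto simp: one_line_def)
  then show ?R
    using f(3) mono range unfolding eq[symmetric] by (intro exI[of _ i] exI[of _ j] exI[of _ k]) auto
next
  have three: "{1..3} = {1, 2, 3::nat}" by auto
  assume ?R
  then obtain i j k where *: "i < j" "j < k" "k < n"
    "\<forall>a\<in>{1..3}. \<forall>b\<in>{1..3}. p (one_line [Suc i, Suc j, Suc k] a) < p (one_line [Suc i, Suc j, Suc k] b)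
          \<longleftrightarrow> s a < s b" by blast
  show ?L
    unfolding contains_pattern_def
  proof (intro bexI conjI)
    show "one_line [Suc i, Suc j, Suc k] \<in> {1..3} \<rightarrow> {1..n}"
      using * unfolding three by (auto simp: one_line_def)
    show "strict_mono_on {1..3} (one_line [Suc i, Suc j, Suc k])"
      using *(1-3) unfolding strict_mono_on_def three by (auto simp: one_line_def)
    show "\<forall>a\<in>{1..3}. \<forall>b\<in>{1..3}. p (one_line [Suc i, Suc j, Suc k] a) < p (one_line [Suc i, Suc j, Suc k] b)
        \<longleftrightarrow> s a < s b"
      by (fact *(4))
  qed
qed

lemma contains_321_iff:
  "contains_pattern n p 3 (one_line [3,2,1]) \<longleftrightarrow> \<not> avoids_321 (map p [1..<Suc n])"
proof -
  have three: "{1..3} = {1, 2, 3::nat}" by auto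
  show ?thesis
    unfolding contains_pattern_3_iff avoids_321_iff_nth not_not three
    by (intro ex_cong1 conj_cong refl) (auto simp: one_line_def simp del: upt_Suc)
qed

lemma contains_132_iff:
  "contains_pattern n p 3 (one_line [1,3,2]) \<longleftrightarrow> \<not> avoids_132 (map p [1..<Suc n])"
proof -
  have three: "{1..3} = {1, 2, 3::nat}" by auto
  show ?thesis
    unfolding contains_pattern_3_iff avoids_132_iff_nth not_not three
    by (intro ex_cong1 conj_cong refl) (auto simp: one_line_def simp del: upt_Suc)
qed

lemma bij_betw_word:
  "bij_betw (\<lambda>p. map p [1..<Suc n]) (sym_perms n) (permutations_of_set {1..n})"
proof (rule bij_betwI[where g = one_line])
  show "(\<lambda>p. map p [1..<Suc n]) \<in> sym_perms n \<rightarrow> permutations_of_set {1..n}"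
  proof
    fix p assume "p \<in> sym_perms n"
    then have p: "p permutes {1..n}" by (simp add: sym_perms_def)
    show "map p [1..<Suc n] \<in> permutations_of_set {1..n}"
      using permutes_image[OF p] permutes_inj_on[OF p]
      by (intro permutations_of_setI) (auto simp: distinct_map atLeastLessThanSuc_atLeastAtMost simp del: upt_Suc)
  qed
  have word_one_line: "map (one_line xs) [1..<Suc n] = xs" if "xs \<in> permutations_of_set {1..n}" for xs
    using length_perm[OF that] by (auto intro!: nth_equalityI simp: one_line_def simp del: upt_Suc)
  show "one_line \<in> permutations_of_set {1..n} \<rightarrow> sym_perms n"
  proof
    fix xs assume xs: "xs \<in> permutations_of_set {1..n}"
    have "one_line xs ` {1..n} = {1..n}"
      using arg_cong[OF word_one_line[OF xs], of set] permutations_of_setD(1)[OF xs]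
      by (simp add: atLeastLessThanSuc_atLeastAtMost del: upt_Suc)
    then have "bij_betw (one_line xs) {1..n} {1..n}"
      by (simp add: bij_betw_def eq_card_imp_inj_on)
    then show "one_line xs \<in> sym_perms n"
      unfolding sym_perms_def mem_Collect_eq
      by (rule bij_imp_permutes) (auto simp: one_line_def length_perm[OF xs])
  qed
  show "map (one_line xs) [1..<Suc n] = xs" if "xs \<in> permutations_of_set {1..n}" for xs
    using that by (rule word_one_line)
  show "one_line (map p [1..<Suc n]) = p" if "p \<in> sym_perms n" for p
  proof
    fix i
    show "one_line (map p [1..<Suc n]) i = p i"
      using that by (auto simp: one_line_def sym_perms_def permutes_def nth_append not_le simp del: upt_Suc)
  qed
qed

lemma card_avoiders_eq_card_words:
  assumes "\<And>p. contains_pattern n p 3 s \<longleftrightarrow> \<not> avoids (map p [1..<Suc n])"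
    and "\<And>p. stat p = word_stat (map p [1..<Suc n])"
  shows "card {p \<in> avoiders n 3 s. stat p = k}
       = card {xs \<in> {xs \<in> permutations_of_set {1..n}. avoids xs}. word_stat xs = k}"
proof -
  have "bij_betw (\<lambda>p. map p [1..<Suc n])
      {p \<in> sym_perms n. avoids (map p [1..<Suc n]) \<and> word_stat (map p [1..<Suc n]) = k}
      {xs \<in> permutations_of_set {1..n}. avoids xs \<and> word_stat xs = k}"
    using bij_betw_word[of n] unfolding bij_betw_def
    by (auto intro: inj_on_subset simp del: upt_Suc)
  from bij_betw_same_card[OF this] show ?thesis
    by (simp add: avoiders_def assms conj_ac del: upt_Suc)
qed

section \<open>Weight enumerators\<close>

definition weight_enum :: "'a set \<Rightarrow> ('a \<Rightarrow> nat) \<Rightarrow> int poly" where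
  "weight_enum S stat = (\<Sum>a\<in>S. monom 1 (stat a))"

abbreviation X :: "int poly" where
  "X \<equiv> monom 1 1"

lemma coeff_weight_enum:
  "finite S \<Longrightarrow> coeff (weight_enum S stat) k = int (card {a \<in> S. stat a = k})"
  by (simp add: weight_enum_def coeff_sum sum.If_cases)
    (simp add: Int_def conj_commute)

lemma weight_enum_zero: "weight_enum S (\<lambda>_. 0) = of_nat (card S)"
  by (simp add: weight_enum_def)

lemma weight_enum_bij:
  assumes "bij_betw f S T" "\<And>a. a \<in> S \<Longrightarrow> stat (f a) = stat' a"
  shows "weight_enum T stat = weight_enum S stat'"
proof -
  have "weight_enum T stat = (\<Sum>a\<in>S. monom 1 (stat (f a)))"
    unfolding weight_enum_def by (rule sum.reindex_bij_betw[OF assms(1), symmetric])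
  then show ?thesis by (simp add: weight_enum_def assms(2))
qed

lemma weight_enum_Times:
  "weight_enum (S \<times> T) (\<lambda>(a, b). f a + g b) = weight_enum S f * weight_enum T g"
  by (simp add: weight_enum_def sum_product sum.cartesian_product mult_monom split_def)

lemma weight_enum_add_const:
  "weight_enum S (\<lambda>a. stat a + c) = weight_enum S stat * X ^ c"
  by (simp add: weight_enum_def sum_distrib_right monom_power mult_monom)

section \<open>Structure of 132-avoiding words\<close>

text \<open>
  Used to recover the sizes of the blocks of a permutation from the order relation between them.
\<close>

lemma initial_segment_of_Un:
  fixes S T :: "nat set"
  assumes "S \<union> T = {1..n}" "\<And>s t. s \<in> S \<Longrightarrow> t \<in> T \<Longrightarrow> s < t"
  shows "S = {1..card S}" "T = {card S + 1..n}"
proof -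
  have fin: "finite S" using assms(1) by (metis finite_Un finite_atLeastAtMost)
  show S: "S = {1..card S}"
  proof (cases "S = {}")
    case False
    have "S = {1..Max S}"
    proof
      show "S \<subseteq> {1..Max S}" using fin assms(1) by auto
      show "{1..Max S} \<subseteq> S"
      proof
        fix x assume x: "x \<in> {1..Max S}"
        have "Max S \<in> S" using fin False by simp
        then have "Max S \<le> n" using assms(1) by auto
        with x have "x \<in> S \<union> T" using assms(1) by auto
        moreover have "x \<notin> T" using assms(2)[OF \<open>Max S \<in> S\<close>, of x] x by auto
        ultimately show "x \<in> S" by blast
      qed
    qed
    then show ?thesis by (metis card_atLeastAtMost diff_Suc_1)
  qed simp
  have "T \<inter> S = {}" using assms(2) by blast
  then have "T = {1..n} - S" using assms(1) by blast
  also have "\<dots> = {card S + 1..n}" by (subst S) auto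
  finally show "T = {card S + 1..n}" .
qed

lemma set_Un_of_split_max:
  assumes "set (us @ Suc n # vs) = {1..Suc n}" "distinct (us @ Suc n # vs)"
  shows "set us \<union> set vs = {1..n}"
proof -
  have "insert (Suc n) (set us \<union> set vs) = set (us @ Suc n # vs)" by simp
  also have "\<dots> = insert (Suc n) {1..n}" unfolding assms(1) by auto
  finally show ?thesis using assms(2) by (subst (asm) insert_ident) auto
qed

lemma sorted_map_add: "sorted (map (\<lambda>y. y + a) xs) \<longleftrightarrow> sorted xs" for a :: nat
  by (induction xs) auto

lemma avoids_132_map_add: "avoids_132 (map (\<lambda>y. y + a) xs) \<longleftrightarrow> avoids_132 xs"
  by (induction xs) (simp_all add: filter_map o_def sorted_map_add)

lemma avoids_321_map_add: "avoids_321 (map (\<lambda>y. y + a) xs) \<longleftrightarrow> avoids_321 xs"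
  by (induction xs) (simp_all add: filter_map o_def sorted_map_add)

lemma Av132_iff: "xs \<in> Av132 n \<longleftrightarrow> set xs = {1..n} \<and> distinct xs \<and> avoids_132 xs"
  and Av321_iff: "xs \<in> Av321 n \<longleftrightarrow> set xs = {1..n} \<and> distinct xs \<and> avoids_321 xs"
  by (auto simp: Av132_def Av321_def permutations_of_set_def)

lemma length_Av132: "xs \<in> Av132 n \<Longrightarrow> length xs = n"
  and length_Av321: "xs \<in> Av321 n \<Longrightarrow> length xs = n"
  unfolding Av132_def Av321_def by (blast intro: length_perm)+

text \<open>
  A letter before the maximum and a larger one after it would form 132 with the maximum in the middle;
  conversely, an occurrence of 132 that is not confined to one side of the maximum starts to the left of
  the maximum and ends to the right of it, so that its 1 and its 2 form such a pair.
\<close>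

lemma avoids_132_append_max:
  assumes "\<And>y. y \<in> set us \<union> set vs \<Longrightarrow> y < m"
  shows "avoids_132 (us @ m # vs) \<longleftrightarrow>
    avoids_132 us \<and> avoids_132 vs \<and> (\<forall>u\<in>set us. \<forall>v\<in>set vs. v \<le> u)"
  using assms
proof (induction us)
  case Nil
  then have "filter (\<lambda>y. m < y) vs = []" by (force simp: filter_empty_conv)
  then show ?case by simp
next
  case (Cons u us)
  have "(\<forall>v\<in>set vs. u < v \<longrightarrow> m \<le> v) \<longleftrightarrow> (\<forall>v\<in>set vs. v \<le> u)"
    using Cons.prems by (auto simp: not_le[symmetric])
  moreover have "sorted (filter (\<lambda>y. u < y) vs)" if "\<forall>v\<in>set vs. v \<le> u"
  proof -
    have "filter (\<lambda>y. u < y) vs = []" using that by (auto simp: filter_empty_conv)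
    then show ?thesis by simp
  qed
  moreover have "u < m" "\<forall>y\<in>set us. y \<le> m" using Cons.prems by (auto intro: less_imp_le)
  moreover have "\<forall>y\<in>set us. \<forall>v\<in>set vs. u < y \<and> u < v \<longrightarrow> y \<le> v" if "\<forall>v\<in>set vs. v \<le> u"
    using that by auto
  ultimately show ?case
    using Cons by (auto simp: sorted_append)
qed

text \<open>
  The Catalan decomposition at the largest entry. The index \<open>a\<close> is the number of entries to its
  right; these carry the values up to \<open>a\<close>, which is why the left block is raised by \<open>a\<close>.
\<close>

lemma Av132_Suc_bij:
  "bij_betw (\<lambda>(a, us, vs). map (\<lambda>y. y + a) us @ Suc n # vs)
     (SIGMA a:{..n}. Av132 (n - a) \<times> Av132 a) (Av132 (Suc n))"
proof -
  let ?f = "\<lambda>(a, us, vs). map (\<lambda>y. y + a) us @ Suc n # vs"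
  let ?S = "SIGMA a:{..n}. Av132 (n - a) \<times> Av132 a"
  have perm: "set us = {1..n - a}" "set vs = {1..a}" "length us = n - a" "length vs = a"
      "distinct us" "distinct vs" "avoids_132 us" "avoids_132 vs" "a \<le> n"
    if "(a, us, vs) \<in> ?S" for a us vs
    using that length_Av132[of us "n - a"] length_Av132[of vs a] by (auto simp: Av132_iff)
  have img: "(\<lambda>y. y + a) ` {1..n - a} = {a + 1..n}" if "a \<le> n" for a
    using that by (simp add: image_add_atLeastAtMost' del: image_add_atLeastAtMost)
  have "inj_on ?f ?S"
  proof (rule inj_onI)
    fix p q assume pq: "p \<in> ?S" "q \<in> ?S" "?f p = ?f q"
    obtain a us vs a' us' vs' where eq: "p = (a, us, vs)" "q = (a', us', vs')"
      by (metis prod_cases3)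
    note 1 = perm[OF pq(1)[unfolded eq]] and 2 = perm[OF pq(2)[unfolded eq]]
    have "Suc n \<notin> set (map (\<lambda>y. y + a) us)" "Suc n \<notin> set vs"
      using 1 img[OF 1(9)] by (simp_all add: 1(1))
    moreover from pq(3) have "map (\<lambda>y. y + a) us @ Suc n # vs = map (\<lambda>y. y + a') us' @ Suc n # vs'"
      by (simp add: eq)
    ultimately have "map (\<lambda>y. y + a) us = map (\<lambda>y. y + a') us'" "vs = vs'"
      by (simp_all add: append_Cons_eq_iff)
    moreover from this have "a = a'" using 1 2 by simp
    ultimately have "map (\<lambda>y. y + a) us = map (\<lambda>y. y + a) us'" by simp
    then have "us = us'"
      by (rule map_injective) (simp add: inj_def)
    with \<open>a = a'\<close> \<open>vs = vs'\<close> show "p = q" by (simp add: eq)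
  qed
  moreover have "?f p \<in> Av132 (Suc n)" if "p \<in> ?S" for p
  proof -
    obtain a us vs where eq: "p = (a, us, vs)"
      by (metis prod_cases3)
    note 1 = perm[OF that[unfolded eq]]
    have set_us: "set (map (\<lambda>y. y + a) us) = {a + 1..n}"
      using img[OF 1(9)] by (simp add: 1(1))
    have "?f p \<in> permutations_of_set {1..Suc n}"
      unfolding eq prod.case
    proof (rule permutations_of_setI)
      show "set (map (\<lambda>y. y + a) us @ Suc n # vs) = {1..Suc n}"
        unfolding set_append list.set(2) set_us 1(2) using 1(9) by auto
      show "distinct (map (\<lambda>y. y + a) us @ Suc n # vs)"
        unfolding distinct_append distinct.simps list.set(2) set_us 1(2)
        using 1(5,6,9) by (auto simp: distinct_map)
    qed
    moreover have "avoids_132 (?f p)"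
    proof -
      have "y < Suc n" if "y \<in> set (map (\<lambda>y. y + a) us) \<union> set vs" for y
        using that 1(9) unfolding set_us 1(2) by auto
      note iff = avoids_132_append_max[OF this]
      have "\<forall>u\<in>set (map (\<lambda>y. y + a) us). \<forall>v\<in>set vs. v \<le> u"
        unfolding set_us 1(2) by auto
      then show ?thesis
        by (simp only: eq prod.case iff avoids_132_map_add 1(7,8) simp_thms)
    qed
    ultimately show ?thesis by (simp add: Av132_def)
  qed
  moreover have "xs \<in> ?f ` ?S" if "xs \<in> Av132 (Suc n)" for xs
  proof -
    from that have xs: "set xs = {1..Suc n}" "distinct xs" "avoids_132 xs"
      by (auto simp: Av132_def permutations_of_setD)
    then obtain us vs where split: "xs = us @ Suc n # vs"
      by (metis atLeastAtMost_iff le_add1 le_refl plus_1_eq_Suc split_list)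
    have un: "set vs \<union> set us = {1..n}"
      using set_Un_of_split_max xs(1,2) unfolding split by (subst Un_commute) blast
    have "y < Suc n" if "y \<in> set us \<union> set vs" for y
      using that un by (auto simp: less_Suc_eq_le)
    note iff = avoids_132_append_max[OF this]
    have less: "v < u" if "v \<in> set vs" "u \<in> set us" for u v
    proof -
      have "v \<le> u" using iff xs(3) that by (simp add: split)
      moreover have "v \<noteq> u" using xs(2) that by (auto simp: split)
      ultimately show ?thesis by simp
    qed
    have av: "avoids_132 us" "avoids_132 vs"
      using iff xs(3) by (simp_all add: split)
    define a where "a = length vs"
    have "distinct us" "distinct vs" using xs(2) by (auto simp: split)
    then have card: "card (set vs) = a" by (simp add: a_def distinct_card)
    have sets: "set vs = {1..a}" "set us = {a + 1..n}"
      using initial_segment_of_Un[OF un less] by (simp_all add: card)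
    have a: "a \<le> n" using un card sets(1) by (metis Un_upper1 card_atLeastAtMost card_mono diff_Suc_1 finite_atLeastAtMost)
    define us' where "us' = map (\<lambda>y. y - a) us"
    have us: "map (\<lambda>y. y + a) us' = us"
      unfolding us'_def map_map using sets(2) by (intro map_idI) auto
    have "distinct us'"
      using \<open>distinct us\<close> us by (metis distinct_map)
    moreover have "set us' = {1..n - a}"
    proof -
      have "(\<lambda>y. y + a) ` set us' = (\<lambda>y. y + a) ` {1..n - a}"
        using us sets(2) img[OF a] by (metis set_map)
      then show ?thesis by (subst (asm) inj_image_eq_iff) (simp_all add: inj_def)
    qed
    ultimately have "(a, us', vs) \<in> ?S"
      using av a sets \<open>distinct vs\<close> us avoids_132_map_add[of a us']
      by (auto simp: Av132_def intro!: permutations_of_setI)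
    then have "?f (a, us', vs) \<in> ?f ` ?S" by (rule imageI)
    moreover have "?f (a, us', vs) = xs" by (simp add: us split)
    ultimately show ?thesis by (simp only:)
  qed
  ultimately show ?thesis unfolding bij_betw_def by blast
qed

section \<open>Diagonal entries of 132-avoiding words\<close>

text \<open>
  The offset is an integer although the statistic of interest has a natural one: the recursion below
  leads to blocks with negative offset.
\<close>

fun diag_count :: "int \<Rightarrow> nat list \<Rightarrow> nat" where
  "diag_count s [] = 0"
| "diag_count s (x # xs) = (if int x = s + 1 then 1 else 0) + diag_count (s + 1) xs"

lemma diag_count_append: "diag_count s (xs @ ys) = diag_count s xs + diag_count (s + int (length xs)) ys"
  by (induction xs arbitrary: s) (simp_all add: algebra_simps)

lemma diag_count_map_add: "diag_count s (map (\<lambda>y. y + a) xs) = diag_count (s - int a) xs"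
  by (induction xs arbitrary: s) (simp_all add: algebra_simps)

lemma diag_count_eq_card:
  "diag_count s xs = card {j. j < length xs \<and> int (xs ! j) = int j + 1 + s}"
proof (induction xs arbitrary: s)
  case (Cons x xs)
  have "{j. j < length (x # xs) \<and> int ((x # xs) ! j) = int j + 1 + s} =
      (if int x = s + 1 then {0} else {}) \<union> Suc ` {j. j < length xs \<and> int (xs ! j) = int j + 1 + (s + 1)}"
    (is "?L = ?A \<union> Suc ` ?B")
  proof (rule set_eqI)
    show "j \<in> ?L \<longleftrightarrow> j \<in> ?A \<union> Suc ` ?B" for j
      by (cases j) (auto simp: image_iff)
  qed
  then have "card ?L = card (?A \<union> Suc ` ?B)" by simp
  also have "\<dots> = card ?A + card (Suc ` ?B)"
    by (rule card_Un_disjoint) auto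
  also have "card (Suc ` ?B) = diag_count (s + 1) xs"
    by (simp add: card_image Cons.IH)
  finally show ?case by simp
qed simp

lemma alpha_stat_eq_diag_count: "alpha_stat r n p = diag_count (int r) (map p [1..<Suc n])"
proof -
  have "{i \<in> {1..n}. p i = i + r} = Suc ` {j. j < n \<and> p (Suc j) = Suc j + r}"
  proof (rule set_eqI)
    show "i \<in> {i \<in> {1..n}. p i = i + r} \<longleftrightarrow> i \<in> Suc ` {j. j < n \<and> p (Suc j) = Suc j + r}" for i
      by (cases i) (auto simp: image_iff)
  qed
  then have "alpha_stat r n p = card {j. j < n \<and> p (Suc j) = Suc j + r}"
    by (simp add: alpha_stat_def card_image)
  also have "{j. j < n \<and> p (Suc j) = Suc j + r} = {j. j < length (map p [1..<Suc n]) \<and>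
      int (map p [1..<Suc n] ! j) = int j + 1 + int r}"
    by (auto simp del: upt_Suc)
  finally show ?thesis by (simp add: diag_count_eq_card)
qed

definition diag_enum :: "nat \<Rightarrow> int \<Rightarrow> int poly" where
  "diag_enum n s = weight_enum (Av132 n) (diag_count s)"

definition card132 :: "nat \<Rightarrow> int poly" where
  "card132 n = of_nat (card (Av132 n))"

lemma Av_0 [simp]: "Av132 0 = {[]}" "Av321 0 = {[]}"
  by (auto simp: Av132_iff Av321_iff)

lemma weight_enum_Av132_Suc:
  assumes "\<And>a us vs. a \<le> n \<Longrightarrow> us \<in> Av132 (n - a) \<Longrightarrow> vs \<in> Av132 a \<Longrightarrow>
    stat (map (\<lambda>y. y + a) us @ Suc n # vs) = f a us + g a vs + h a"
  shows "weight_enum (Av132 (Suc n)) stat =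
    (\<Sum>a\<le>n. weight_enum (Av132 (n - a)) (f a) * weight_enum (Av132 a) (g a) * X ^ h a)"
proof -
  have "weight_enum (Av132 (Suc n)) stat =
      weight_enum (SIGMA a:{..n}. Av132 (n - a) \<times> Av132 a) (\<lambda>(a, us, vs). f a us + g a vs + h a)"
    by (rule weight_enum_bij[OF Av132_Suc_bij]) (auto simp: assms)
  also have "\<dots> = (\<Sum>a\<le>n. weight_enum (Av132 (n - a) \<times> Av132 a) (\<lambda>p. (case p of (us, vs) \<Rightarrow> f a us + g a vs) + h a))"
    unfolding weight_enum_def by (subst sum.Sigma) (auto simp: split_def)
  finally show ?thesis
    by (simp add: weight_enum_add_const weight_enum_Times)
qed

lemma card132_Suc: "card132 (Suc n) = (\<Sum>a\<le>n. card132 a * card132 (n - a))"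
  using weight_enum_Av132_Suc[of n "\<lambda>_. 0" "\<lambda>_ _. 0" "\<lambda>_ _. 0" "\<lambda>_. 0"]
  by (simp add: weight_enum_zero card132_def mult.commute)

text \<open>
  The left block is raised by \<open>a\<close>, which lowers its offset by \<open>a\<close>. The right block starts after
  \<open>n - a + 1\<close> positions, which raises its offset by that amount. The maximum itself
  stands at position \<open>n - a + 1\<close> and lies on the diagonal exactly when \<open>s = a\<close>.
\<close>

lemma diag_enum_Suc:
  "diag_enum (Suc n) s = (\<Sum>a\<le>n. diag_enum (n - a) (s - int a) *
     diag_enum a (s + int (Suc (n - a))) * (if s = int a then X else 1))"
proof -
  have "diag_enum (Suc n) s = (\<Sum>a\<le>n. diag_enum (n - a) (s - int a) *
     diag_enum a (s + int (Suc (n - a))) * X ^ (if s = int a then 1 else 0))"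
    unfolding diag_enum_def
    by (rule weight_enum_Av132_Suc)
      (simp add: diag_count_append diag_count_map_add length_Av132, auto simp: algebra_simps)
  then show ?thesis by (simp only: if_distrib[of "\<lambda>k. X ^ k"] power_one_right power_0)
qed

text \<open>
  The sum in the common recurrence, with an arbitrary \<open>h\<close> in place of the enumerators of offset 0:
  \<open>i\<close> is the size of the part that surrounds, or precedes, a distinguished point, and must be at least \<open>r\<close>.
\<close>

definition tail_convolution :: "(nat \<Rightarrow> int poly) \<Rightarrow> (nat \<Rightarrow> int poly) \<Rightarrow> nat \<Rightarrow> nat \<Rightarrow> int poly" where
  "tail_convolution c h r n = (\<Sum>i<n. if r \<le> i then c i * h (n - 1 - i) else 0)"

lemma tail_convolution_eq_0: "n \<le> r \<Longrightarrow> tail_convolution c h r n = 0"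
  by (auto simp: tail_convolution_def intro!: sum.neutral)

text \<open>
  The algebraic core of the 132-case. The first two sums both run over triples of sizes
  \<open>(a, i, n - 1 - a - i)\<close>. The first requires \<open>a - i \<le> s \<le> a + i\<close>; the second, after exchanging
  \<open>a\<close> and \<open>i\<close>, requires \<open>- (a + i + 1) \<le> s < a - i\<close>. The two ranges are disjoint and their
  union depends on \<open>a + i\<close> only, so the Catalan recurrence contracts \<open>c a * c i\<close> to \<open>c (a + i + 1)\<close>. The boundary value \<open>s = i\<close> that
  the left-hand side has in addition is the last summand.
\<close>

lemma tail_convolution_Suc_conv:
  fixes c h :: "nat \<Rightarrow> int poly" and s :: int
  assumes c_Suc: "\<And>n. c (Suc n) = (\<Sum>a\<le>n. c a * c (n - a))"
  shows "tail_convolution c h (nat \<bar>s\<bar>) (Suc n) =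
    (\<Sum>a\<le>n. c a * tail_convolution c h (nat \<bar>s - int a\<bar>) (n - a)
            + c (n - a) * tail_convolution c h (nat \<bar>s + int (Suc (n - a))\<bar>) a)
    + (if 0 \<le> s \<and> s \<le> int n then c (nat s) * h (n - nat s) else 0)"
proof -
  let ?T = "{(i, j). i + j < n}"
  define t where "t a i = c a * c i * h (n - 1 - (a + i))" for a i
  have swap: "(\<Sum>(a, i)\<in>?T. f a i) = (\<Sum>(a, i)\<in>?T. f i a)" for f :: "nat \<Rightarrow> nat \<Rightarrow> int poly"
    by (rule sum.reindex_bij_witness[of _ prod.swap prod.swap]) auto
  have triangle: "(\<Sum>a\<le>n. \<Sum>i<n - a. f a i) = (\<Sum>(a, i)\<in>?T. f a i)" for f :: "nat \<Rightarrow> nat \<Rightarrow> int poly"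
  proof -
    have "?T = (SIGMA a:{..n}. {..<n - a})" by auto
    then show ?thesis by (simp add: sum.Sigma)
  qed
  have "(\<Sum>a\<le>n. c a * tail_convolution c h (nat \<bar>s - int a\<bar>) (n - a)) =
      (\<Sum>a\<le>n. \<Sum>i<n - a. if \<bar>s - int a\<bar> \<le> int i then t a i else 0)"
    unfolding tail_convolution_def sum_distrib_left t_def
    by (intro sum.cong refl) (auto simp: nat_le_iff algebra_simps)
  then have 1: "(\<Sum>a\<le>n. c a * tail_convolution c h (nat \<bar>s - int a\<bar>) (n - a)) =
      (\<Sum>(a, i)\<in>?T. if \<bar>s - int a\<bar> \<le> int i then t a i else 0)"
    by (simp only: triangle)
  have "(\<Sum>a\<le>n. c (n - a) * tail_convolution c h (nat \<bar>s + int (Suc (n - a))\<bar>) a) =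
      (\<Sum>a\<le>n. c a * tail_convolution c h (nat \<bar>s + int (Suc a)\<bar>) (n - a))"
    by (rule sum.reindex_bij_witness[of _ "\<lambda>a. n - a" "\<lambda>a. n - a"]) auto
  also have "\<dots> = (\<Sum>a\<le>n. \<Sum>i<n - a. if \<bar>s + int (Suc a)\<bar> \<le> int i then t a i else 0)"
    unfolding tail_convolution_def sum_distrib_left t_def
    by (intro sum.cong refl) (auto simp: nat_le_iff algebra_simps)
  also have "\<dots> = (\<Sum>(a, i)\<in>?T. if \<bar>s + int (Suc i)\<bar> \<le> int a then t i a else 0)"
    unfolding triangle by (rule swap)
  finally have 2: "(\<Sum>a\<le>n. c (n - a) * tail_convolution c h (nat \<bar>s + int (Suc (n - a))\<bar>) a) =
      (\<Sum>(a, i)\<in>?T. if \<bar>s + int (Suc i)\<bar> \<le> int a then t a i else 0)"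
    by (simp add: t_def mult.commute add.commute cong: if_cong)
  have "(\<Sum>a\<le>n. c a * tail_convolution c h (nat \<bar>s - int a\<bar>) (n - a)
            + c (n - a) * tail_convolution c h (nat \<bar>s + int (Suc (n - a))\<bar>) a) =
      (\<Sum>(a, i)\<in>?T. (if \<bar>s - int a\<bar> \<le> int i then t a i else 0) +
          (if \<bar>s + int (Suc i)\<bar> \<le> int a then t a i else 0))"
    unfolding sum.distrib 1 2 by (simp add: sum.distrib split_def)
  also have "\<dots> = (\<Sum>(a, i)\<in>?T. if - int (Suc (a + i)) \<le> s \<and> s \<le> int (a + i) then t a i else 0)"
    by (intro sum.cong refl) auto
  also have "\<dots> = (\<Sum>k<n. \<Sum>a\<le>k. if - int (Suc k) \<le> s \<and> s \<le> int k then t a (k - a) else 0)"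
    unfolding sum.triangle_reindex by (intro sum.cong refl) auto
  also have "\<dots> = (\<Sum>k<n. if - int (Suc k) \<le> s \<and> s \<le> int k then c (Suc k) * h (n - Suc k) else 0)"
    by (intro sum.cong refl) (auto simp: c_Suc t_def sum_distrib_right intro!: sum.neutral)
  finally have "(\<Sum>a\<le>n. c a * tail_convolution c h (nat \<bar>s - int a\<bar>) (n - a)
            + c (n - a) * tail_convolution c h (nat \<bar>s + int (Suc (n - a))\<bar>) a) =
      (\<Sum>i\<in>{1..n}. if \<bar>s\<bar> \<le> int i \<and> s \<noteq> int i then c i * h (n - i) else 0)"
    unfolding One_nat_def sum.atLeast1_atMost_eq by (auto intro!: sum.cong)
  also have "\<dots> = (\<Sum>i\<le>n. if \<bar>s\<bar> \<le> int i \<and> s \<noteq> int i then c i * h (n - i) else 0)"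
    by (rule sum.mono_neutral_left) auto
  finally have "(\<Sum>a\<le>n. c a * tail_convolution c h (nat \<bar>s - int a\<bar>) (n - a)
            + c (n - a) * tail_convolution c h (nat \<bar>s + int (Suc (n - a))\<bar>) a) =
      (\<Sum>i\<le>n. if \<bar>s\<bar> \<le> int i \<and> s \<noteq> int i then c i * h (n - i) else 0)" .
  moreover have "(if 0 \<le> s \<and> s \<le> int n then c (nat s) * h (n - nat s) else 0) =
      (\<Sum>i\<le>n. if s = int i then c i * h (n - i) else 0)"
  proof (cases "0 \<le> s")
    case True
    then obtain m where "s = int m" using nonneg_int_cases by blast
    then show ?thesis by simp
  qed (auto intro!: sum.neutral[symmetric])
  moreover have "tail_convolution c h (nat \<bar>s\<bar>) (Suc n) =
      (\<Sum>i\<le>n. (if \<bar>s\<bar> \<le> int i \<and> s \<noteq> int i then c i * h (n - i) else 0)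
            + (if s = int i then c i * h (n - i) else 0))"
    unfolding tail_convolution_def lessThan_Suc_atMost by (intro sum.cong refl) auto
  ultimately show ?thesis by (simp add: sum.distrib)
qed

text \<open>
  Substituting the formula for both blocks of the decomposition, the product of the two correction
  terms vanishes and the linear terms are those of \<open>tail_convolution_Suc_conv\<close>. The boundary summand of
  that identity comes from the one position of the maximum on the diagonal: there the right block
  has a larger offset than size, so that it contributes only a Catalan number.
\<close>

lemma diag_enum_eq:
  "diag_enum n s = card132 n + (X - 1) * tail_convolution card132 (\<lambda>m. diag_enum m 0) (nat \<bar>s\<bar>) n"
proof (induction n arbitrary: s rule: less_induct)
  case (less n)
  show ?case
  proof (cases n)
    case 0
    then show ?thesis
      by (simp add: diag_enum_def card132_def tail_convolution_def weight_enum_def)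
  next
    case (Suc m)
    let ?c = card132 and ?h = "\<lambda>m. diag_enum m 0"
    let ?G = "\<lambda>r. tail_convolution ?c ?h (nat \<bar>r\<bar>)"
    define p where "p a = diag_enum (m - a) (s - int a)" for a
    define q where "q a = diag_enum a (s + int (Suc (m - a)))" for a
    have p: "p a = ?c (m - a) + (X - 1) * ?G (s - int a) (m - a)" for a
      unfolding p_def by (rule less.IH) (simp add: Suc)
    have q: "q a = ?c a + (X - 1) * ?G (s + int (Suc (m - a))) a" if "a \<le> m" for a
      unfolding q_def by (rule less.IH) (use that Suc in simp)
    have pq: "p a * q a = ?c a * ?c (m - a) + (X - 1) * (?c a * ?G (s - int a) (m - a)
        + ?c (m - a) * ?G (s + int (Suc (m - a))) a)" if "a \<le> m" for a
    proof -
      \<comment> \<open>The absolute offsets of the two blocks add up to at least \<open>m + 1\<close>, one more than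
        their sizes together, so some block is no larger than its offset.\<close>
      have "?G (s - int a) (m - a) = 0 \<or> ?G (s + int (Suc (m - a))) a = 0"
      proof (cases "\<bar>s - int a\<bar> < int (m - a)")
        case True
        then have "a \<le> nat \<bar>s + int (Suc (m - a))\<bar>" using that by linarith
        then show ?thesis by (simp add: tail_convolution_eq_0)
      qed (simp add: tail_convolution_eq_0)
      then show ?thesis unfolding p q[OF that] by (auto simp: algebra_simps)
    qed
    have extra: "(\<Sum>a\<le>m. if s = int a then p a * q a else 0) =
        (if 0 \<le> s \<and> s \<le> int m then ?c (nat s) * ?h (m - nat s) else 0)"
    proof (cases "0 \<le> s")
      case True
      then obtain a where a: "s = int a" using nonneg_int_cases by blast
      have "q a = ?c a" if "a \<le> m"
        unfolding q[OF that] by (simp add: a tail_convolution_eq_0)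
      then show ?thesis by (auto simp: a p_def mult.commute)
    qed (auto intro!: sum.neutral)
    have "diag_enum n s = (\<Sum>a\<le>m. p a * q a * (if s = int a then X else 1))"
      unfolding Suc diag_enum_Suc p_def q_def ..
    also have "\<dots> = (\<Sum>a\<le>m. p a * q a) + (X - 1) * (\<Sum>a\<le>m. if s = int a then p a * q a else 0)"
      unfolding sum_distrib_left sum.distrib[symmetric]
      by (intro sum.cong refl) (simp add: algebra_simps)
    also have "(\<Sum>a\<le>m. p a * q a) = ?c n + (X - 1) * (\<Sum>a\<le>m. ?c a * ?G (s - int a) (m - a)
        + ?c (m - a) * ?G (s + int (Suc (m - a))) a)"
      unfolding Suc card132_Suc sum_distrib_left sum.distrib[symmetric]
      by (intro sum.cong refl) (simp add: pq)
    finally show ?thesis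
      unfolding extra Suc by (simp only: tail_convolution_Suc_conv[OF card132_Suc]) (simp add: algebra_simps)
  qed
qed

section \<open>Counting 321-avoiding words\<close>

text \<open>
  Where the maximum may be inserted into a 321-avoider depends on how long its final increasing run is.
  Hence the additional parameter: all descents lie within the first \<open>t\<close> letters or at the border to the
  rest.
\<close>

definition ballot_words :: "nat \<Rightarrow> nat \<Rightarrow> nat list set" where
  "ballot_words n t = {xs \<in> Av321 n. sorted (drop t xs)}"

text \<open>
  A descent after the maximum would be completed to 321; apart from that the maximum is harmless,
  as it can play only the first role in the pattern.
\<close>

lemma avoids_321_append_max:
  assumes "\<And>y. y \<in> set us \<union> set vs \<Longrightarrow> y < m"
  shows "avoids_321 (us @ m # vs) \<longleftrightarrow> avoids_321 (us @ vs) \<and> sorted vs"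
  using assms
proof (induction us)
  case Nil
  then have "filter (\<lambda>y. y < m) vs = vs" by (auto simp: filter_id_conv)
  then show ?case by auto
next
  case (Cons u us)
  have "\<not> m < u" using Cons.prems[of u] by simp
  with Cons show ?case by auto
qed

text \<open>
  Removing the maximum from such a word leaves a word increasing from the old position \<open>p\<close> of the
  maximum on. Position \<open>p < t\<close> is compatible with the run condition, as is the last position,
  where the run condition is inherited; positions in between would create a descent too far right.
  The index \<open>p = t\<close>, which is otherwise free, encodes insertion at the end.
\<close>

lemma ballot_words_Suc_bij:
  assumes "t \<le> n"
  shows "bij_betw (\<lambda>(p, ys). take (if p = t then n else p) ys @ Suc n # drop (if p = t then n else p) ys)
    (SIGMA p:{..t}. ballot_words n p) (ballot_words (Suc n) t)"
proof -
  let ?q = "\<lambda>p. if p = t then n else p"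
  let ?f = "\<lambda>(p, ys). take (?q p) ys @ Suc n # drop (?q p) ys"
  let ?S = "SIGMA p:{..t}. ballot_words n p"
  have perm: "set ys = {1..n}" "distinct ys" "length ys = n" "avoids_321 ys" "sorted (drop p ys)"
    if "ys \<in> ballot_words n p" for p ys
    using that length_Av321[of ys n] by (auto simp: Av321_iff ballot_words_def)
  have "inj_on ?f ?S"
  proof (rule inj_onI)
    fix x y assume xy: "x \<in> ?S" "y \<in> ?S" "?f x = ?f y"
    obtain p ys p' ys' where eq: "x = (p, ys)" "y = (p', ys')" by fastforce
    have mem: "ys \<in> ballot_words n p" "ys' \<in> ballot_words n p'" "p \<le> t" "p' \<le> t"
      using xy(1,2) by (auto simp: eq)
    have "Suc n \<notin> set ys" using perm(1)[OF mem(1)] by simp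
    then have "Suc n \<notin> set (take (?q p) ys)" "Suc n \<notin> set (drop (?q p) ys)"
      by (meson in_set_takeD in_set_dropD)+
    moreover have "take (?q p) ys @ Suc n # drop (?q p) ys = take (?q p') ys' @ Suc n # drop (?q p') ys'"
      using xy(3) by (simp add: eq)
    ultimately have *: "take (?q p) ys = take (?q p') ys'" "drop (?q p) ys = drop (?q p') ys'"
      using append_Cons_eq_iff[of "Suc n" "take (?q p) ys" "drop (?q p) ys"] by blast+
    then have "ys = ys'" by (metis append_take_drop_id)
    moreover have "?q p = ?q p'"
    proof -
      have "length (take (?q p) ys) = ?q p" "length (take (?q p') ys') = ?q p'"
        using mem assms perm(3)[OF mem(1)] perm(3)[OF mem(2)] by auto
      then show ?thesis using *(1) by metis
    qed
    then have "p = p'" using mem(3,4) assms by (auto split: if_splits)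
    ultimately show "x = y" by (simp add: eq)
  qed
  moreover have "?f x \<in> ballot_words (Suc n) t" if "x \<in> ?S" for x
  proof -
    obtain p ys where eq: "x = (p, ys)" by fastforce
    have p: "p \<le> t" and ys: "ys \<in> ballot_words n p" using that by (auto simp: eq)
    note 1 = perm[OF ys]
    define us vs where "us = take (?q p) ys" and "vs = drop (?q p) ys"
    then have ys_eq: "ys = us @ vs" and len: "length us = ?q p"
      using assms p 1(3) by auto
    have f: "?f x = us @ Suc n # vs" by (simp add: eq us_def vs_def)
    have un: "set us \<union> set vs = {1..n}" using 1(1) by (simp add: ys_eq)
    have "sorted vs" using 1(3,5) by (simp add: vs_def)
    have "y < Suc n" if "y \<in> set us \<union> set vs" for y
      using that unfolding un by simp
    from avoids_321_append_max[OF this] have "avoids_321 (us @ Suc n # vs)"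
      using 1(4) \<open>sorted vs\<close> by (simp add: ys_eq)
    moreover have "set (us @ Suc n # vs) = {1..Suc n}"
    proof -
      have "set (us @ Suc n # vs) = insert (Suc n) (set us \<union> set vs)" by simp
      also have "\<dots> = {1..Suc n}" unfolding un by auto
      finally show ?thesis .
    qed
    moreover have "distinct (us @ Suc n # vs)"
    proof -
      have "Suc n \<notin> set us \<union> set vs" unfolding un by simp
      then show ?thesis using 1(2) by (simp add: ys_eq)
    qed
    moreover have "sorted (drop t (us @ Suc n # vs))"
    proof (cases "p = t")
      case True
      then have "vs = []" "us = ys" using 1(3) by (simp_all add: us_def vs_def)
      moreover have "\<forall>y\<in>set (drop t ys). y \<le> Suc n"
        using 1(1) in_set_dropD[of _ t ys] by (auto intro: le_SucI)
      ultimately show ?thesis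
        using 1(3,5) assms True by (simp add: sorted_append)
    next
      case False
      then obtain k where "t - p = Suc k" using p by (cases "t - p") auto
      then show ?thesis
        using False len \<open>sorted vs\<close> by (simp add: sorted_wrt_drop)
    qed
    ultimately show ?thesis unfolding f by (simp add: ballot_words_def Av321_iff)
  qed
  moreover have "xs \<in> ?f ` ?S" if "xs \<in> ballot_words (Suc n) t" for xs
  proof -
    from that have xs: "set xs = {1..Suc n}" "distinct xs" "avoids_321 xs" "length xs = Suc n"
        "sorted (drop t xs)"
      using length_Av321[of xs "Suc n"] by (auto simp: Av321_iff ballot_words_def)
    then obtain us vs where split: "xs = us @ Suc n # vs"
      by (metis atLeastAtMost_iff le_add1 le_refl plus_1_eq_Suc split_list)
    have un: "set us \<union> set vs = {1..n}"
      using set_Un_of_split_max xs(1,2) unfolding split by blast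
    have "y < Suc n" if "y \<in> set us \<union> set vs" for y
      using that un by auto
    from avoids_321_append_max[OF this] have av: "avoids_321 (us @ vs)" "sorted vs"
      using xs(3) unfolding split by blast+
    have ys: "us @ vs \<in> Av321 n" using av un xs(2) by (auto simp: Av321_iff split)
    have len: "length us + length vs = n" using xs(4) by (simp add: split)
    show ?thesis
    proof (cases "length us < t")
      case True
      then have "(length us, us @ vs) \<in> ?S" using ys av by (simp add: ballot_words_def)
      then have "?f (length us, us @ vs) \<in> ?f ` ?S" by (rule imageI)
      moreover have "?f (length us, us @ vs) = xs" using True by (simp add: split)
      ultimately show ?thesis by (simp only:)
    next
      case False
      have "vs = []"
      proof (rule ccontr)
        assume "vs \<noteq> []"
        then obtain v where "v \<in> set vs" by (meson last_in_set)
        moreover have "sorted (drop t us @ Suc n # vs)" using xs(5) False by (simp add: split)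
        ultimately have "Suc n \<le> v" by (simp add: sorted_append)
        moreover have "v \<in> {1..n}" unfolding un[symmetric] using \<open>v \<in> set vs\<close> by blast
        ultimately show False by simp
      qed
      then have "sorted (drop t us)" using xs(5) False by (simp add: split sorted_append)
      then have "(t, us @ vs) \<in> ?S" using ys \<open>vs = []\<close> by (simp add: ballot_words_def)
      then have "?f (t, us @ vs) \<in> ?f ` ?S" by (rule imageI)
      moreover have "?f (t, us @ vs) = xs" using len by (simp add: split \<open>vs = []\<close>)
      ultimately show ?thesis by (simp only:)
    qed
  qed
  ultimately show ?thesis unfolding bij_betw_def by blast
qed

lemma finite_ballot_words [simp]: "finite (ballot_words n t)"
  by (simp add: ballot_words_def)

lemma card_ballot_words_Suc:
  "t \<le> n \<Longrightarrow> card (ballot_words (Suc n) t) = (\<Sum>p\<le>t. card (ballot_words n p))"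
  using bij_betw_same_card[OF ballot_words_Suc_bij[of t n]] by simp

lemma ballot_words_last: "ballot_words (Suc n) (Suc n) = ballot_words (Suc n) n"
proof -
  have "sorted (drop n xs)" if "xs \<in> Av321 (Suc n)" for xs
  proof -
    have "length (drop n xs) = 1" using length_Av321[OF that] by simp
    then show ?thesis by (metis One_nat_def length_0_conv length_Suc_conv sorted1)
  qed
  then show ?thesis by (auto simp: ballot_words_def length_Av321)
qed

definition catalan_fps :: "int poly fps" where
  "catalan_fps = Abs_fps card132"

lemma card132_0 [simp]: "card132 0 = 1"
  by (simp add: card132_def)

lemma catalan_fps_eq: "catalan_fps = 1 + fps_X * catalan_fps\<^sup>2"
proof (rule fps_ext)
  fix n
  have "fps_nth (catalan_fps\<^sup>2) m = card132 (Suc m)" for m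
    by (simp add: catalan_fps_def power2_eq_square fps_mult_nth card132_Suc atLeast0AtMost)
  then show "fps_nth catalan_fps n = fps_nth (1 + fps_X * catalan_fps\<^sup>2) n"
    by (cases n) (simp_all add: catalan_fps_def)
qed

lemma catalan_fps_power_nth_Suc:
  "fps_nth (catalan_fps ^ Suc k) (Suc m) = fps_nth (catalan_fps ^ k) (Suc m) + fps_nth (catalan_fps ^ (k + 2)) m"
proof -
  have "catalan_fps ^ Suc k = catalan_fps ^ k * (1 + fps_X * catalan_fps\<^sup>2)"
    using catalan_fps_eq by simp
  also have "\<dots> = catalan_fps ^ k + fps_X * catalan_fps ^ (k + 2)"
    by (simp add: algebra_simps power_add power2_eq_square)
  finally show ?thesis by (simp del: power_Suc)
qed

text \<open>
  Subtracting consecutive values of \<open>card_ballot_words_Suc\<close> gives the recursion of the ballot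
  triangle, which the powers of the Catalan series satisfy by \<open>catalan_fps_power_nth_Suc\<close>.
\<close>

lemma card_ballot_words:
  "t \<le> n \<Longrightarrow> of_nat (card (ballot_words n t)) = fps_nth (catalan_fps ^ Suc (n - t)) t"
proof (induction n arbitrary: t)
  case 0
  have "ballot_words 0 0 = {[]}" by (auto simp: ballot_words_def)
  with 0 show ?case by (simp add: catalan_fps_def)
next
  case (Suc n)
  note IH = Suc.IH
  show ?case using Suc.prems
  proof (induction t)
    case 0
    have "of_nat (card (ballot_words (Suc n) 0)) = fps_nth (catalan_fps ^ Suc n) 0"
      using IH[of 0] by (simp add: card_ballot_words_Suc)
    then show ?case by (simp add: fps_power_zeroth catalan_fps_def)
  next
    case (Suc t)
    have step: "fps_nth (catalan_fps ^ Suc (Suc n - Suc t)) (Suc t) =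
        fps_nth (catalan_fps ^ (n - t)) (Suc t) + of_nat (card (ballot_words (Suc n) t))"
      using Suc catalan_fps_power_nth_Suc[of "n - t" t] by (simp add: Suc_diff_le)
    show ?case
    proof (cases "t = n")
      case True
      then show ?thesis using step by (simp add: ballot_words_last)
    next
      case False
      then have t: "Suc t \<le> n" using Suc.prems by simp
      then have "fps_nth (catalan_fps ^ (n - t)) (Suc t) = of_nat (card (ballot_words n (Suc t)))"
        using IH[of "Suc t"] Suc_diff_Suc[of t n] by simp
      then show ?thesis using t step by (simp add: card_ballot_words_Suc)
    qed
  qed
qed

lemma card_Av321_eq_card_Av132: "of_nat (card (Av321 n)) = card132 n"
proof -
  have "ballot_words n n = Av321 n" by (auto simp: ballot_words_def length_Av321)
  then show ?thesis using card_ballot_words[of n n] by (simp add: catalan_fps_def)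
qed

section \<open>Fixed points of 321-avoiding words\<close>

definition fix_count :: "nat \<Rightarrow> nat list \<Rightarrow> nat" where
  "fix_count r xs = card {j. r \<le> j \<and> j < length xs \<and> xs ! j = Suc j}"

lemma beta_stat_eq_fix_count: "beta_stat r n p = fix_count r (map p [1..<Suc n])"
proof -
  have "{i \<in> {1..n}. r < i \<and> p i = i} = Suc ` {j. r \<le> j \<and> j < n \<and> p (Suc j) = Suc j}"
  proof (rule set_eqI)
    show "i \<in> {i \<in> {1..n}. r < i \<and> p i = i} \<longleftrightarrow>
        i \<in> Suc ` {j. r \<le> j \<and> j < n \<and> p (Suc j) = Suc j}" for i
      by (cases i) (auto simp: image_iff)
  qed
  then have "beta_stat r n p = card {j. r \<le> j \<and> j < n \<and> p (Suc j) = Suc j}"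
    by (simp add: beta_stat_def card_image)
  also have "{j. r \<le> j \<and> j < n \<and> p (Suc j) = Suc j} =
      {j. r \<le> j \<and> j < length (map p [1..<Suc n]) \<and> map p [1..<Suc n] ! j = Suc j}"
    by (auto simp del: upt_Suc)
  finally show ?thesis by (simp add: fix_count_def)
qed

lemma avoids_321_append_between:
  assumes "\<forall>u\<in>set us. u < m" "\<forall>v\<in>set vs. m < v"
  shows "avoids_321 (us @ m # vs) \<longleftrightarrow> avoids_321 us \<and> avoids_321 vs"
  using assms(1)
proof (induction us)
  case Nil
  have "filter (\<lambda>y. y < m) vs = []" using assms(2) by (auto simp: filter_empty_conv)
  then show ?case by simp
next
  case (Cons u us)
  have "filter (\<lambda>y. y < u) (m # vs) = []"
    using Cons.prems assms(2) by (auto simp: filter_empty_conv)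
  then have "filter (\<lambda>y. y < u) (us @ m # vs) = filter (\<lambda>y. y < u) us" by simp
  then show ?case using Cons by simp
qed

lemma avoids_321_appendD:
  "avoids_321 (us @ m # vs) \<Longrightarrow> u \<in> set us \<Longrightarrow> m < u \<Longrightarrow> v \<in> set vs \<Longrightarrow> m \<le> v"
proof (induction us)
  case (Cons w us)
  then show ?case by (cases "u = w") (force simp: sorted_append)+
qed simp

text \<open>
  The prefix has exactly as many letters as there are values below the fixed point. If one of its
  letters were larger than the fixed point, some smaller value would have to come later,
  and the three would form 321.
\<close>

lemma Av321_split_at_fixed_point:
  assumes "us @ Suc (length us) # vs \<in> Av321 n"
  shows "set us = {1..length us}" "set vs = {Suc (Suc (length us))..n}"
proof -
  let ?i = "length us"
  from assms have av: "avoids_321 (us @ Suc ?i # vs)" and dist: "distinct us" "Suc ?i \<notin> set us \<union> set vs" "set us \<inter> set vs = {}"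
    and "set (us @ Suc ?i # vs) = {1..n}"
    by (auto simp: Av321_iff)
  then have un: "insert (Suc ?i) (set us \<union> set vs) = {1..n}" by simp
  then have "Suc ?i \<le> n" by (metis atLeastAtMost_iff insertI1)
  have "u < Suc ?i" if u: "u \<in> set us" for u
  proof (rule ccontr)
    assume "\<not> u < Suc ?i"
    then have "Suc ?i < u" using dist(2) u by (cases "u = Suc ?i") auto
    with av u have "\<forall>v\<in>set vs. Suc ?i \<le> v" using avoids_321_appendD by blast
    have "{1..?i} \<subseteq> set us"
    proof
      fix y assume "y \<in> {1..?i}"
      then have "y \<in> {1..n}" "y < Suc ?i" using \<open>Suc ?i \<le> n\<close> by auto
      then show "y \<in> set us"
        using \<open>\<forall>v\<in>set vs. Suc ?i \<le> v\<close> unfolding un[symmetric] by auto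
    qed
    moreover have "card (set us) = card {1..?i}" using dist(1) by (simp add: distinct_card)
    ultimately have "{1..?i} = set us" by (intro card_subset_eq) auto
    then have "u \<in> {1..?i}" using u by simp
    then show False using \<open>Suc ?i < u\<close> by simp
  qed
  moreover have "u \<ge> 1" if "u \<in> set us" for u
  proof -
    have "u \<in> {1..n}" using that unfolding un[symmetric] by simp
    then show ?thesis by simp
  qed
  ultimately have "set us \<subseteq> {1..?i}" by (auto simp: less_Suc_eq_le)
  moreover have "card (set us) = card {1..?i}" using dist(1) by (simp add: distinct_card)
  ultimately show us: "set us = {1..?i}" by (intro card_subset_eq) auto
  have "set vs = {1..n} - insert (Suc ?i) (set us)"
    using dist(2,3) unfolding un[symmetric] by auto
  also have "\<dots> = {Suc (Suc ?i)..n}" unfolding us using \<open>Suc ?i \<le> n\<close> by auto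
  finally show "set vs = {Suc (Suc ?i)..n}" .
qed

lemma Av321_fixed_point_bij:
  assumes "i < n"
  shows "bij_betw (\<lambda>(us, vs). us @ Suc i # map (\<lambda>y. y + Suc i) vs)
    (Av321 i \<times> Av321 (n - 1 - i)) {xs \<in> Av321 n. xs ! i = Suc i}"
proof -
  let ?f = "\<lambda>(us, vs). us @ Suc i # map (\<lambda>y. y + Suc i) vs"
  let ?S = "Av321 i \<times> Av321 (n - 1 - i)"
  let ?T = "{xs \<in> Av321 n. xs ! i = Suc i}"
  have img: "(\<lambda>y. y + Suc i) ` {1..n - 1 - i} = {Suc (Suc i)..n}"
    using assms by (subst image_add_atLeastAtMost') simp
  have "inj_on ?f ?S"
  proof (rule inj_onI)
    fix p q assume pq: "p \<in> ?S" "q \<in> ?S" "?f p = ?f q"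
    obtain us vs us' vs' where eq: "p = (us, vs)" "q = (us', vs')" by fastforce
    have "length us = length us'"
      using pq(1,2) length_Av321[of us i] length_Av321[of us' i] by (simp add: eq)
    with pq(3) have "us = us'" "map (\<lambda>y. y + Suc i) vs = map (\<lambda>y. y + Suc i) vs'"
      by (simp_all add: eq)
    then show "p = q" unfolding eq by (simp add: inj_map_eq_map inj_def)
  qed
  moreover have "?f p \<in> ?T" if "p \<in> ?S" for p
  proof -
    obtain us vs where eq: "p = (us, vs)" by fastforce
    have mem: "us \<in> Av321 i" "vs \<in> Av321 (n - 1 - i)" using that by (auto simp: eq)
    then have 1: "set us = {1..i}" "set vs = {1..n - 1 - i}" "distinct us" "distinct vs"
      "avoids_321 us" "avoids_321 vs" "length us = i"
      using length_Av321[OF mem(1)] by (auto simp: Av321_iff)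
    have set_vs: "set (map (\<lambda>y. y + Suc i) vs) = {Suc (Suc i)..n}"
      unfolding set_map 1(2) by (rule img)
    have "\<forall>u\<in>set us. u < Suc i" "\<forall>v\<in>set (map (\<lambda>y. y + Suc i) vs). Suc i < v"
      unfolding set_vs 1(1) by auto
    from avoids_321_append_between[OF this]
    have "avoids_321 (?f p)" unfolding eq prod.case avoids_321_map_add using 1(5,6) by blast
    moreover have "set (?f p) = {1..n}"
    proof -
      have "set (?f p) = {1..i} \<union> insert (Suc i) {Suc (Suc i)..n}"
        unfolding eq prod.case set_append list.set(2) set_vs 1(1) ..
      also have "\<dots> = {1..n}" using assms by auto
      finally show ?thesis .
    qed
    moreover have "distinct (?f p)"
      unfolding eq prod.case distinct_append distinct.simps list.set(2) set_vs 1(1)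
      using 1(3,4) by (auto simp: distinct_map inj_on_def)
    ultimately show ?thesis using 1(7) by (simp add: Av321_iff eq nth_append)
  qed
  moreover have "xs \<in> ?f ` ?S" if "xs \<in> ?T" for xs
  proof -
    have xs: "xs \<in> Av321 n" "xs ! i = Suc i" "length xs = n"
      using that length_Av321[of xs n] by auto
    define us vs where "us = take i xs" and "vs = drop (Suc i) xs"
    have len: "length us = i" using xs(3) assms by (simp add: us_def)
    have split: "xs = us @ Suc i # vs"
      using id_take_nth_drop[of i xs] assms xs by (simp add: us_def vs_def)
    from Av321_split_at_fixed_point[of us vs n] have sets: "set us = {1..i}" "set vs = {Suc (Suc i)..n}"
      using xs(1) unfolding split len by auto
    define vs' where "vs' = map (\<lambda>y. y - Suc i) vs"
    have vs: "map (\<lambda>y. y + Suc i) vs' = vs"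
      unfolding vs'_def map_map using sets(2) by (intro map_idI) auto
    have av: "avoids_321 us" "avoids_321 vs"
    proof -
      have "\<forall>u\<in>set us. u < Suc i" "\<forall>v\<in>set vs. Suc i < v" unfolding sets by auto
      from avoids_321_append_between[OF this] show "avoids_321 us" "avoids_321 vs"
        using xs(1) unfolding split Av321_iff by blast+
    qed
    have dist: "distinct us" "distinct vs" using xs(1) by (auto simp: Av321_iff split)
    have "set vs' = {1..n - 1 - i}"
    proof -
      have "(\<lambda>y. y + Suc i) ` set vs' = (\<lambda>y. y + Suc i) ` {1..n - 1 - i}"
        unfolding img sets(2)[symmetric] using vs by (metis set_map)
      then show ?thesis by (subst (asm) inj_image_eq_iff) (simp_all add: inj_def)
    qed
    moreover have "distinct vs'" using dist(2) vs by (metis distinct_map)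
    moreover have "avoids_321 vs'" using av(2) vs avoids_321_map_add by metis
    ultimately have "(us, vs') \<in> ?S" using av(1) sets(1) dist(1) by (simp add: Av321_iff)
    then have "?f (us, vs') \<in> ?f ` ?S" by (rule imageI)
    moreover have "?f (us, vs') = xs" unfolding prod.case vs split ..
    ultimately show ?thesis by (simp only:)
  qed
  ultimately show ?thesis unfolding bij_betw_def by blast
qed

lemma fix_count_append_map_add:
  assumes "length us = i"
  shows "fix_count (Suc i) (us @ Suc i # map (\<lambda>y. y + Suc i) vs) = fix_count 0 vs"
proof -
  have "{j. Suc i \<le> j \<and> j < length (us @ Suc i # map (\<lambda>y. y + Suc i) vs) \<and>
        (us @ Suc i # map (\<lambda>y. y + Suc i) vs) ! j = Suc j} =
      (\<lambda>j. j + Suc i) ` {j. j < length vs \<and> vs ! j = Suc j}" (is "?L = ?R")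
  proof (rule set_eqI)
    fix j
    show "j \<in> ?L \<longleftrightarrow> j \<in> ?R"
    proof (cases "Suc i \<le> j")
      case True
      then obtain k where "j = k + Suc i" by (metis add.commute le_iff_add)
      then show ?thesis using assms by (auto simp: nth_append)
    qed auto
  qed
  then show ?thesis by (simp add: fix_count_def card_image inj_on_def)
qed

text \<open>
  This is $X^m - 1 = (X - 1)(1 + \cdots + X^{m-1})$, with each exponent read as the number of
  elements that follow a distinguished one.
\<close>

lemma X_power_card_eq:
  fixes S :: "nat set"
  assumes "finite S"
  shows "X ^ card S = 1 + (X - 1) * (\<Sum>i\<in>S. X ^ card {j \<in> S. i < j})"
  using assms
proof (induction S rule: finite_linorder_min_induct)
  case (insert b A)
  have "{j \<in> insert b A. b < j} = A" using insert.hyps by auto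
  moreover have "{j \<in> insert b A. i < j} = {j \<in> A. i < j}" if "i \<in> A" for i
    using insert.hyps that by auto
  moreover have "b \<notin> A" using insert.hyps by blast
  ultimately have "(\<Sum>i\<in>insert b A. X ^ card {j \<in> insert b A. i < j}) =
      X ^ card A + (\<Sum>i\<in>A. X ^ card {j \<in> A. i < j})"
    using insert.hyps(1) by simp
  moreover have "X ^ card (insert b A) = X * X ^ card A"
    using \<open>b \<notin> A\<close> insert.hyps(1) by simp
  moreover have "X * X ^ card A = X ^ card A + (X - 1) * X ^ card A" by (simp add: algebra_simps)
  ultimately show ?case using insert.IH by (simp only: distrib_left add_ac)
qed simp

lemma X_power_fix_count:
  assumes "length xs = n"
  shows "X ^ fix_count r xs =
    1 + (X - 1) * (\<Sum>i<n. if r \<le> i \<and> xs ! i = Suc i then X ^ fix_count (Suc i) xs else 0)"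
proof -
  let ?S = "{j. r \<le> j \<and> j < length xs \<and> xs ! j = Suc j}"
  have "X ^ fix_count r xs = 1 + (X - 1) * (\<Sum>i\<in>?S. X ^ card {j \<in> ?S. i < j})"
    unfolding fix_count_def by (rule X_power_card_eq) simp
  also have "(\<Sum>i\<in>?S. X ^ card {j \<in> ?S. i < j}) = (\<Sum>i\<in>?S. X ^ fix_count (Suc i) xs)"
    unfolding fix_count_def by (intro sum.cong refl arg_cong[where f = "\<lambda>A. X ^ card A"]) auto
  also have "\<dots> = (\<Sum>i<n. if r \<le> i \<and> xs ! i = Suc i then X ^ fix_count (Suc i) xs else 0)"
    using assms by (intro sum.mono_neutral_cong_left) auto
  finally show ?thesis .
qed

definition fix_enum :: "nat \<Rightarrow> nat \<Rightarrow> int poly" where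
  "fix_enum n r = weight_enum (Av321 n) (fix_count r)"

text \<open>
  The recurrence for 321-avoiders: summing the previous expansion over all words, the terms for a
  fixed point \<open>i + 1\<close> factor according to \<open>Av321_fixed_point_bij\<close>. After that point the lower bound \<open>r\<close> is
  automatic, which is why offset 0 appears on the right.
\<close>

lemma fix_enum_eq:
  "fix_enum n r = card132 n + (X - 1) * tail_convolution card132 (\<lambda>m. fix_enum m 0) r n"
proof -
  have X: "weight_enum S stat = (\<Sum>xs\<in>S. X ^ stat xs)" for S :: "nat list set" and stat
    by (simp add: weight_enum_def monom_power)
  have factor: "(\<Sum>xs\<in>{xs \<in> Av321 n. xs ! i = Suc i}. X ^ fix_count (Suc i) xs) =
      card132 i * fix_enum (n - 1 - i) 0" if "i < n" for i
  proof -
    have "(\<Sum>xs\<in>{xs \<in> Av321 n. xs ! i = Suc i}. X ^ fix_count (Suc i) xs) =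
        weight_enum (Av321 i \<times> Av321 (n - 1 - i)) (\<lambda>(us, vs). 0 + fix_count 0 vs)"
      unfolding X[symmetric]
      by (rule weight_enum_bij[OF Av321_fixed_point_bij[OF that]])
        (clarify, simp only: prod.case add_0 fix_count_append_map_add[OF length_Av321])
    also have "\<dots> = card132 i * fix_enum (n - 1 - i) 0"
      unfolding weight_enum_Times fix_enum_def weight_enum_zero card_Av321_eq_card_Av132 ..
    finally show ?thesis .
  qed
  have "fix_enum n r = (\<Sum>xs\<in>Av321 n. 1 + (X - 1) *
      (\<Sum>i<n. if r \<le> i \<and> xs ! i = Suc i then X ^ fix_count (Suc i) xs else 0))"
    unfolding fix_enum_def X by (intro sum.cong refl X_power_fix_count length_Av321)
  also have "\<dots> = card132 n + (X - 1) *
      (\<Sum>xs\<in>Av321 n. \<Sum>i<n. if r \<le> i \<and> xs ! i = Suc i then X ^ fix_count (Suc i) xs else 0)"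
    by (simp add: sum.distrib sum_distrib_left card_Av321_eq_card_Av132)
  also have "(\<Sum>xs\<in>Av321 n. \<Sum>i<n. if r \<le> i \<and> xs ! i = Suc i then X ^ fix_count (Suc i) xs else 0) =
      (\<Sum>i<n. \<Sum>xs\<in>Av321 n. if r \<le> i \<and> xs ! i = Suc i then X ^ fix_count (Suc i) xs else 0)"
    by (rule sum.swap)
  also have "\<dots> = (\<Sum>i<n. if r \<le> i
      then \<Sum>xs\<in>{xs \<in> Av321 n. xs ! i = Suc i}. X ^ fix_count (Suc i) xs else 0)"
    by (intro sum.cong refl) (simp add: sum.inter_filter del: One_nat_def)
  also have "\<dots> = tail_convolution card132 (\<lambda>m. fix_enum m 0) r n"
    unfolding tail_convolution_def by (intro sum.cong refl) (simp add: factor del: One_nat_def)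
  finally show ?thesis .
qed

section \<open>Equidistribution\<close>

lemma tail_convolution_cong: "(\<And>m. m < n \<Longrightarrow> h m = h' m) \<Longrightarrow> tail_convolution c h r n = tail_convolution c h' r n"
  unfolding tail_convolution_def by (intro sum.cong refl) auto

lemma fix_enum_eq_diag_enum: "fix_enum n r = diag_enum n (int r)"
proof (induction n arbitrary: r rule: less_induct)
  case (less n)
  have "tail_convolution card132 (\<lambda>m. fix_enum m 0) r n = tail_convolution card132 (\<lambda>m. diag_enum m 0) r n"
    by (rule tail_convolution_cong) (use less[of _ 0] in simp)
  then show ?case by (simp add: fix_enum_eq[of n r] diag_enum_eq[of n])
qed

theorem theorem9:
  fixes r n k :: nat
  assumes "k \<le> n"
  shows "card {p \<in> avoiders n 3 (one_line [3,2,1]). beta_stat r n p = k}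
       = card {p \<in> avoiders n 3 (one_line [1,3,2]). alpha_stat r n p = k}"
proof -
  have words_321: "card {p \<in> avoiders n 3 (one_line [3,2,1]). beta_stat r n p = k} =
      card {xs \<in> Av321 n. fix_count r xs = k}"
    unfolding Av321_def
    by (rule card_avoiders_eq_card_words[where avoids = avoids_321 and
          word_stat = "fix_count r", OF contains_321_iff beta_stat_eq_fix_count])
  have words_132: "card {p \<in> avoiders n 3 (one_line [1,3,2]). alpha_stat r n p = k} =
      card {xs \<in> Av132 n. diag_count (int r) xs = k}"
    unfolding Av132_def
    by (rule card_avoiders_eq_card_words[where avoids = avoids_132 and
          word_stat = "diag_count (int r)", OF contains_132_iff alpha_stat_eq_diag_count])
  have "int (card {xs \<in> Av321 n. fix_count r xs = k}) = coeff (fix_enum n r) k"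
    by (simp add: fix_enum_def coeff_weight_enum)
  also have "\<dots> = coeff (diag_enum n (int r)) k"
    by (simp add: fix_enum_eq_diag_enum)
  also have "\<dots> = int (card {xs \<in> Av132 n. diag_count (int r) xs = k})"
    by (simp add: diag_enum_def coeff_weight_enum)
  finally show ?thesis
    unfolding words_321 words_132 by simp
qed

end
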